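(* Assume: (a) $U(u,t)$ is nondecreasing in $u$ and in $t$, and $\lim_{t\to+\infty}U(u,t)=+\infty$ for every $u\ge0$; (b) there exist constants $u_*\ge0$, $c_*>0$, $L>0$ such that $U(u,t)\ge u+c_*t$ for all $u\ge u_*$, $t\ge 0$, and $(\alpha/c_* )\int_0^{+\infty}e^{Lz}[1-F(z)]\,dz\le1$. Let $\varphi:[0,+\infty)\to[0,1]$ be the (unique) nondecreasing solution of $\varphi=A\varphi$ with $\lim_{u\to+\infty}\varphi(u)=1$. Let $\varphi^0$ satisfy $1\ge\varphi^0(u)\ge\max\{0,1-e^{-L(u-u_* )}\}$ for all $u\ge0$ and let $\varphi^{k+1}=A\varphi^k$, $k=0,1,\dots$. Then $\|\varphi^k-\varphi\|=\sup_{u\ge0}|\varphi^k(u)-\varphi(u)|$ converges monotonically to zero. Moreover, for every $\varepsilon>0$ there is $q(\varepsilon)$ with $0\le q(\varepsilon)<1$ such that $$\|\varphi^k-\varphi\|\le(q(\varepsilon))^k\,\|\varphi^0-\varphi\|$$ for all $k$ such that $\|\varphi^k-\varphi\|\ge\varepsilon$.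
   Context: $\alpha>0$ is the intensity of the Poisson claim flow; $F$ is the distribution function of claim sizes, $F(z)=0$ for $z\le0$, with finite mean $\mu$. $c(\cdot)\ge0$ is a piecewise continuous premium rate and $U(u,t)$, $u,t\ge0$, is the solution of the Cauchy problem $dU/dt=c(U)$, $U(u,0)=u$, assumed well defined for all $t\ge0$. The operator $A$ acts on bounded Borel functions $\varphi:[0,+\infty)\to\mathbb R$ by $$A\varphi(u)=\int_0^{+\infty}\alpha e^{-\alpha t}\int_0^{U(u,t)}\varphi(U(u,t)-z)\,dF(z)\,dt,\qquad u\ge0,$$ where the inner integral is a Lebesgue–Stieltjes integral over $[0,U(u,t)]$. Under (a), (b) the solution $\varphi$ exists and is unique. All initial functions are Borel measurable. *)

theory Defs
  imports "HOL-Probability.Probability"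
begin

definition claim_df :: "(real \<Rightarrow> real) \<Rightarrow> bool" where
  "claim_df F \<longleftrightarrow>
     mono F \<and> (\<forall>z. continuous (at_right z) F) \<and> (F \<longlongrightarrow> 1) at_top \<and> (\<forall>z\<le>0. F z = 0)"

text \<open>Finitely many discontinuities on every bounded interval, all with finite one-sided limits.
  At \<open>s = 0\<close> the left limit is vacuous, since \<open>at 0 within {0..<0}\<close> is the bottom filter.\<close>

definition piecewise_continuous :: "(real \<Rightarrow> real) \<Rightarrow> bool" where
  "piecewise_continuous c \<longleftrightarrow>
     (\<forall>T>0. \<exists>S. finite S \<and> S \<subseteq> {0..T} \<and> continuous_on ({0..T} - S) c \<and>
        (\<forall>s\<in>S. (\<exists>l. (c \<longlongrightarrow> l) (at s within {0..<s})) \<and>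
               (\<exists>l. (c \<longlongrightarrow> l) (at s within {s<..}))))"

text \<open>As \<open>c\<close> may jump, a solution of \<open>dx/dt = c(x)\<close> can have a kink when it crosses a discontinuity
  of \<open>c\<close>. A solution is therefore a continuous function satisfying the equation at all but finitely
  many times of every bounded interval.\<close>

definition premium_solution :: "(real \<Rightarrow> real) \<Rightarrow> real \<Rightarrow> (real \<Rightarrow> real) \<Rightarrow> bool" where
  "premium_solution c u x \<longleftrightarrow>
     x 0 = u \<and> continuous_on {0..} x \<and> (\<forall>t\<ge>0. 0 \<le> x t) \<and>
     (\<forall>T>0. \<exists>S. finite S \<and>
        (\<forall>t\<in>{0..T} - S. (x has_real_derivative c (x t)) (at t within {0..})))"

definition premium_flow :: "(real \<Rightarrow> real) \<Rightarrow> (real \<Rightarrow> real \<Rightarrow> real) \<Rightarrow> bool" where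
  "premium_flow c U \<longleftrightarrow>
     (\<forall>u\<ge>0. premium_solution c u (U u) \<and>
        (\<forall>x. premium_solution c u x \<longrightarrow> (\<forall>t\<ge>0. x t = U u t)))"

text \<open>Functions on \<open>[0,\<infinity>)\<close> are represented by functions on the reals whose values at
  negative arguments are irrelevant.\<close>

definition risk_op ::
    "real \<Rightarrow> (real \<Rightarrow> real) \<Rightarrow> (real \<Rightarrow> real \<Rightarrow> real) \<Rightarrow> (real \<Rightarrow> real) \<Rightarrow> real \<Rightarrow> real" where
  "risk_op \<alpha> F U \<phi> u =
     (LINT t:{0..}|lborel. \<alpha> * exp (- \<alpha> * t) *
        (LINT z:{0..U u t}|interval_measure F. \<phi> (U u t - z)))"

definition sup_norm :: "(real \<Rightarrow> real) \<Rightarrow> real" where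
  "sup_norm f = (SUP u\<in>{0..}. \<bar>f u\<bar>)"

end

theory Submission
  imports Defs "HOL-Real_Asymp.Real_Asymp"
begin

text \<open>
  On \<open>[0,\<infinity>)\<close> the operator \<open>A\<close> is the Markov kernel of the surplus just after the next claim, killed
  on leaving \<open>[0,\<infinity>)\<close>; so it is linear and positive, and \<open>\<phi>\<^sup>k - \<phi> = A\<^sup>k (\<phi>\<^sup>0 - \<phi>)\<close>.
  Since \<open>E exp (L z) = 1 + L \<integral> exp (L s) (1 - F s) ds \<le> 1 + L cstar / \<alpha>\<close>, the function
  \<open>b u = min 1 (exp (- L (u - ustar)))\<close> is a supermartingale for the surplus. A maximum principle gives
  \<open>1 - \<phi> \<le> b\<close>, hence \<open>\<bar>\<phi>\<^sup>0 - \<phi>\<bar> \<le> b\<close>, and \<open>A b \<le> b\<close> propagates this bound to all \<open>\<phi>\<^sup>k - \<phi>\<close>, which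
  are therefore at most \<open>\<epsilon>/2\<close> on some \<open>[M,\<infinity>)\<close>, uniformly in \<open>k\<close>. One step of the process reaches
  \<open>[M,\<infinity>)\<close> with probability at least some \<open>p > 0\<close> from every starting point, so as long as the
  error is at least \<open>\<epsilon>\<close> it shrinks by the factor \<open>1 - p/2\<close>.
\<close>

section \<open>Geometric decay above a threshold\<close>

lemma geometric_bound_above_threshold:
  fixes e :: "nat \<Rightarrow> real"
  assumes "decseq e" and "0 \<le> q" and contract: "\<And>k. \<epsilon> \<le> e k \<Longrightarrow> e (Suc k) \<le> q * e k"
    and "\<epsilon> \<le> e k"
  shows "e k \<le> q ^ k * e 0"
  using assms(4)
proof (induction k)
  case (Suc k)
  have above: "\<epsilon> \<le> e k"
    using Suc.prems decseq_SucD[OF \<open>decseq e\<close>, of k] by simp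
  have "e (Suc k) \<le> q * e k"
    by (rule contract[OF above])
  also have "\<dots> \<le> q * (q ^ k * e 0)"
    using Suc.IH[OF above] \<open>0 \<le> q\<close> by (rule mult_left_mono)
  finally show ?case by simp
qed simp

lemma tendsto_0_if_geometric_above_thresholds:
  fixes e :: "nat \<Rightarrow> real"
  assumes nonneg: "\<And>k. 0 \<le> e k"
    and geometric: "\<And>\<epsilon>. 0 < \<epsilon> \<Longrightarrow> \<exists>q. 0 \<le> q \<and> q < 1 \<and> (\<forall>k. \<epsilon> \<le> e k \<longrightarrow> e k \<le> q ^ k * e 0)"
  shows "e \<longlonglongrightarrow> 0"
proof (rule order_tendstoI)
  fix \<epsilon> :: real assume "0 < \<epsilon>"
  then obtain q where q: "0 \<le> q" "q < 1" and above: "\<And>k. \<epsilon> \<le> e k \<Longrightarrow> e k \<le> q ^ k * e 0"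
    using geometric by blast
  have "(\<lambda>k. q ^ k * e 0) \<longlonglongrightarrow> 0"
    using q by (intro tendsto_mult_left_zero LIMSEQ_realpow_zero)
  then have "\<forall>\<^sub>F k in sequentially. q ^ k * e 0 < \<epsilon>"
    using \<open>0 < \<epsilon>\<close> by (rule order_tendstoD)
  then show "\<forall>\<^sub>F k in sequentially. e k < \<epsilon>"
    by eventually_elim (meson above le_less_trans not_le order_less_irrefl)
next
  show "\<forall>\<^sub>F k in sequentially. x < e k" if "x < 0" for x
    using that nonneg by (auto intro: always_eventually less_le_trans)
qed

section \<open>Bounded Borel functions on the half-line\<close>

definition bounded_borel :: "(real \<Rightarrow> real) \<Rightarrow> bool" where
  "bounded_borel f \<longleftrightarrow> set_borel_measurable borel {0..} f \<and> bounded (f ` {0..})"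

lemma bounded_borelI:
  assumes "set_borel_measurable borel {0..} f" and "\<And>u. 0 \<le> u \<Longrightarrow> \<bar>f u\<bar> \<le> B"
  shows "bounded_borel f"
  using assms unfolding bounded_borel_def bounded_iff by (metis atLeast_iff imageE real_norm_def)

lemma bounded_borel_measurable:
  "bounded_borel f \<Longrightarrow> (\<lambda>u. indicator {0..} u * f u) \<in> borel_measurable borel"
  by (simp add: bounded_borel_def set_borel_measurable_def)

lemma bounded_borel_cong:
  assumes "\<And>u. 0 \<le> u \<Longrightarrow> f u = g u"
  shows "bounded_borel f \<longleftrightarrow> bounded_borel g"
proof -
  have "(\<lambda>u. indicator {0..} u *\<^sub>R f u) = (\<lambda>u. indicator {0..} u *\<^sub>R g u)"
    and "f ` {0..} = g ` {0..}"
    using assms by (auto simp: indicator_def fun_eq_iff)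
  then show ?thesis
    unfolding bounded_borel_def set_borel_measurable_def by simp
qed

lemma bounded_borel_abs:
  assumes "bounded_borel f"
  shows "bounded_borel (\<lambda>u. \<bar>f u\<bar>)"
proof -
  have "set_borel_measurable borel {0..} (\<lambda>u. \<bar>f u\<bar>)"
    using borel_measurable_abs[OF bounded_borel_measurable[OF assms]]
    by (simp add: set_borel_measurable_def abs_mult)
  then show ?thesis
    using assms by (simp add: bounded_borel_def bounded_iff)
qed

lemma bounded_borel_diff:
  assumes f: "bounded_borel f" and g: "bounded_borel g"
  shows "bounded_borel (\<lambda>u. f u - g u)"
proof -
  have "set_borel_measurable borel {0..} (\<lambda>u. f u - g u)"
    using borel_measurable_diff[OF bounded_borel_measurable[OF f] bounded_borel_measurable[OF g]]
    by (simp add: set_borel_measurable_def right_diff_distrib)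
  then show ?thesis
    using f g by (simp add: bounded_borel_def bounded_minus_comp)
qed

lemma bounded_borel_mono_on:
  assumes "mono_on {0..} f" and "\<And>u. 0 \<le> u \<Longrightarrow> \<bar>f u\<bar> \<le> B"
  shows "bounded_borel f"
proof (rule bounded_borelI[OF _ assms(2)])
  show "set_borel_measurable borel {0..} f"
    using borel_measurable_mono_on_fnc[OF assms(1)]
    by (simp add: set_borel_measurable_def borel_measurable_restrict_space_iff)
qed

lemma sup_norm_le: "(\<And>u. 0 \<le> u \<Longrightarrow> \<bar>f u\<bar> \<le> b) \<Longrightarrow> sup_norm f \<le> b"
  unfolding sup_norm_def by (rule cSUP_least) auto

lemma sup_norm_cong: "(\<And>u. 0 \<le> u \<Longrightarrow> f u = g u) \<Longrightarrow> sup_norm f = sup_norm g"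
  unfolding sup_norm_def by (rule SUP_cong) auto

lemma abs_le_sup_norm:
  assumes "bounded_borel f" and "0 \<le> u"
  shows "\<bar>f u\<bar> \<le> sup_norm f"
proof -
  have "bdd_above ((\<lambda>u. \<bar>f u\<bar>) ` {0..})"
    using assms(1) by (auto simp: bounded_borel_def bounded_iff intro: bdd_aboveI)
  then show ?thesis
    unfolding sup_norm_def using assms(2) by (intro cSUP_upper) auto
qed

lemma sup_norm_nonneg: "bounded_borel f \<Longrightarrow> 0 \<le> sup_norm f"
  using abs_le_sup_norm[of f 0] by simp

section \<open>Killed Markov kernels\<close>

locale killed_kernel =
  fixes K :: "real \<Rightarrow> real measure"
  assumes measurable_kernel: "K \<in> borel \<rightarrow>\<^sub>M prob_algebra borel"
begin

definition killed_op :: "(real \<Rightarrow> real) \<Rightarrow> real \<Rightarrow> real" where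
  "killed_op f u = (LINT x:{0..}|K u. f x)"

lemma sets_kernel [measurable_cong, simp]: "sets (K u) = sets borel"
  using measurable_space[OF measurable_kernel, of u] by (simp add: space_prob_algebra)

sublocale kernel: prob_space "K u" for u
  using measurable_space[OF measurable_kernel, of u] by (simp add: space_prob_algebra)

lemma set_integrable_kernel:
  assumes "bounded_borel f"
  shows "set_integrable (K u) {0..} f"
proof -
  note [measurable] = bounded_borel_measurable[OF assms]
  have "norm (indicator {0..} x * f x) \<le> sup_norm f" for x
    using abs_le_sup_norm[OF assms, of x] sup_norm_nonneg[OF assms] by (simp add: indicator_def)
  then show ?thesis
    unfolding set_integrable_def real_scaleR_def
    by (intro kernel.integrable_const_bound[of _ "sup_norm f"]) auto
qed

lemma killed_op_cong: "(\<And>x. 0 \<le> x \<Longrightarrow> f x = g x) \<Longrightarrow> killed_op f = killed_op g"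
  unfolding killed_op_def by (intro ext set_lebesgue_integral_cong) auto

lemma killed_op_diff:
  "bounded_borel f \<Longrightarrow> bounded_borel g \<Longrightarrow>
    killed_op (\<lambda>x. f x - g x) u = killed_op f u - killed_op g u"
  by (simp add: killed_op_def set_integral_diff set_integrable_kernel)

lemma abs_killed_op_le:
  assumes "bounded_borel f" and "bounded_borel g" and "\<And>x. 0 \<le> x \<Longrightarrow> \<bar>f x\<bar> \<le> g x"
  shows "\<bar>killed_op f u\<bar> \<le> killed_op g u"
proof -
  have "\<bar>killed_op f u\<bar> \<le> (LINT x:{0..}|K u. \<bar>f x\<bar>)"
    using set_integral_norm_bound[OF set_integrable_kernel[OF assms(1)]]
    by (simp add: killed_op_def)
  also have "\<dots> \<le> killed_op g u"
    unfolding killed_op_def using assms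
    by (intro set_integral_mono set_integrable_abs set_integrable_kernel) auto
  finally show ?thesis .
qed

lemma killed_op_le:
  assumes h: "bounded_borel h" and "0 \<le> M" and "0 \<le> D" and "d \<le> D"
    and le_D: "\<And>x. 0 \<le> x \<Longrightarrow> h x \<le> D" and tail: "\<And>x. M \<le> x \<Longrightarrow> h x \<le> d"
    and overshoot_M: "p \<le> measure (K u) {M..}"
  shows "killed_op h u \<le> D - p * (D - d)"
proof -
  have integrable_indicator: "integrable (K u) (\<lambda>x. indicat_real {M..} x)"
    by (rule kernel.integrable_const_bound[of _ 1]) auto
  have "killed_op h u \<le> (\<integral>x. D - (D - d) * indicator {M..} x \<partial>K u)"
    unfolding killed_op_def set_lebesgue_integral_def
  proof (rule integral_mono)
    show "integrable (K u) (\<lambda>x. indicator {0..} x *\<^sub>R h x)"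
      using set_integrable_kernel[OF h] by (simp add: set_integrable_def)
    show "integrable (K u) (\<lambda>x. D - (D - d) * indicator {M..} x)"
      using integrable_indicator by simp
    show "indicator {0..} x *\<^sub>R h x \<le> D - (D - d) * indicator {M..} x" for x
      using le_D[of x] tail[of x] assms(2-4) by (auto simp: indicator_def)
  qed
  also have "\<dots> = D - measure (K u) {M..} * (D - d)"
    using integrable_indicator sets.Int_space_eq2[of "{M..}" "K u"]
    by (simp add: kernel.prob_space)
  also have "\<dots> \<le> D - p * (D - d)"
    using overshoot_M \<open>d \<le> D\<close> by (simp add: mult_right_mono)
  finally show ?thesis .
qed

lemma bounded_borel_killed_op:
  assumes f: "bounded_borel f"
  shows "bounded_borel (killed_op f)"
proof (rule bounded_borelI)
  note [measurable] = bounded_borel_measurable[OF f]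
  have "killed_op f \<in> borel_measurable borel"
    unfolding killed_op_def[abs_def] set_lebesgue_integral_def real_scaleR_def
    by (rule measurable_compose[OF measurable_prob_algebraD[OF measurable_kernel]]) measurable
  then show "set_borel_measurable borel {0..} (killed_op f)"
    by (simp add: set_borel_measurable_def)
  fix u :: real
  have "\<bar>killed_op f u\<bar> \<le> killed_op (\<lambda>x. \<bar>f x\<bar>) u"
    using f by (intro abs_killed_op_le bounded_borel_abs) auto
  also have "\<dots> \<le> sup_norm f"
    using killed_op_le[OF bounded_borel_abs[OF f],
        where M=0 and p=0 and D="sup_norm f" and d="sup_norm f"]
      abs_le_sup_norm[OF f] sup_norm_nonneg[OF f]
    by simp
  finally show "\<bar>killed_op f u\<bar> \<le> sup_norm f" .
qed

lemma bounded_borel_funpow_killed_op: "bounded_borel f \<Longrightarrow> bounded_borel ((killed_op ^^ k) f)"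
  by (induction k) (auto intro: bounded_borel_killed_op)

lemma funpow_killed_op_diff_fixed_point:
  assumes "bounded_borel f" and "bounded_borel g" and fixed: "\<And>u. 0 \<le> u \<Longrightarrow> killed_op g u = g u"
    and "0 \<le> u"
  shows "(killed_op ^^ k) (\<lambda>x. f x - g x) u = (killed_op ^^ k) f u - g u"
  using assms(4)
proof (induction k arbitrary: u)
  case (Suc k)
  have "(killed_op ^^ Suc k) (\<lambda>x. f x - g x) u = killed_op (\<lambda>x. (killed_op ^^ k) f x - g x) u"
    using killed_op_cong[OF Suc.IH] by simp
  also have "\<dots> = (killed_op ^^ Suc k) f u - g u"
    using assms(1,2) Suc.prems
    by (simp add: killed_op_diff bounded_borel_funpow_killed_op fixed)
  finally show ?case .
qed simp

lemma abs_funpow_killed_op_le: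
  assumes "bounded_borel h" and "bounded_borel b" and "\<And>x. 0 \<le> x \<Longrightarrow> \<bar>h x\<bar> \<le> b x"
    and super: "\<And>u. 0 \<le> u \<Longrightarrow> killed_op b u \<le> b u" and "0 \<le> u"
  shows "\<bar>(killed_op ^^ k) h u\<bar> \<le> b u"
  using assms(5)
proof (induction k arbitrary: u)
  case (Suc k)
  have "\<bar>(killed_op ^^ Suc k) h u\<bar> \<le> killed_op b u"
    using assms(1,2) Suc.IH by (simp add: abs_killed_op_le bounded_borel_funpow_killed_op)
  also have "\<dots> \<le> b u"
    by (rule super[OF Suc.prems])
  finally show ?case .
qed (use assms(3) in simp)

lemma sup_norm_killed_op_le:
  assumes h: "bounded_borel h" and "0 \<le> M" and "d \<le> sup_norm h"
    and "\<And>x. M \<le> x \<Longrightarrow> \<bar>h x\<bar> \<le> d" and "\<And>u. 0 \<le> u \<Longrightarrow> p \<le> measure (K u) {M..}"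
  shows "sup_norm (killed_op h) \<le> sup_norm h - p * (sup_norm h - d)"
proof (rule sup_norm_le)
  fix u :: real assume "0 \<le> u"
  have "\<bar>killed_op h u\<bar> \<le> killed_op (\<lambda>x. \<bar>h x\<bar>) u"
    using h by (intro abs_killed_op_le bounded_borel_abs) auto
  also have "\<dots> \<le> sup_norm h - p * (sup_norm h - d)"
    using assms \<open>0 \<le> u\<close>
    by (intro killed_op_le bounded_borel_abs) (auto intro: sup_norm_nonneg abs_le_sup_norm)
  finally show "\<bar>killed_op h u\<bar> \<le> sup_norm h - p * (sup_norm h - d)" .
qed

lemma decseq_sup_norm_funpow_killed_op:
  assumes "bounded_borel h"
  shows "decseq (\<lambda>k. sup_norm ((killed_op ^^ k) h))"
proof (rule decseq_SucI)
  show "sup_norm ((killed_op ^^ Suc k) h) \<le> sup_norm ((killed_op ^^ k) h)" for k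
    using sup_norm_killed_op_le[OF bounded_borel_funpow_killed_op[OF assms, of k],
        where M=0 and d="sup_norm ((killed_op ^^ k) h)" and p=0]
      abs_le_sup_norm[OF bounded_borel_funpow_killed_op[OF assms]]
    by simp
qed

end

locale overshooting_kernel = killed_kernel +
  assumes overshoot: "\<exists>p>0. \<forall>u\<ge>0. p \<le> measure (K u) {M..}"
begin

text \<open>A weak maximum principle: a positive supremum would be reduced by the mass that one step
  sends to the far right, where \<open>h\<close> is small.\<close>

lemma nonpos_of_le_killed_op:
  assumes h: "bounded_borel h" and sub: "\<And>u. 0 \<le> u \<Longrightarrow> h u \<le> killed_op h u"
    and decay: "\<And>\<epsilon>. 0 < \<epsilon> \<Longrightarrow> \<forall>\<^sub>F x in at_top. h x \<le> \<epsilon>" and "0 \<le> u"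
  shows "h u \<le> 0"
proof (rule ccontr)
  assume "\<not> h u \<le> 0"
  define D where "D = (SUP x\<in>{0..}. h x)"
  have "bdd_above (h ` {0..})"
    using h by (simp add: bounded_borel_def bounded_imp_bdd_above)
  then have le_D: "h x \<le> D" if "0 \<le> x" for x
    unfolding D_def using that by (intro cSUP_upper) auto
  have "0 < D"
    using le_D[OF \<open>0 \<le> u\<close>] \<open>\<not> h u \<le> 0\<close> by simp
  then have "\<forall>\<^sub>F x in at_top. 0 \<le> x \<and> h x \<le> D / 2"
    by (intro eventually_conj eventually_ge_at_top decay) simp
  then obtain M where "0 \<le> M" and tail: "\<And>x. M \<le> x \<Longrightarrow> h x \<le> D / 2"
    unfolding eventually_at_top_linorder by blast
  obtain p where "0 < p" and overshoot_M: "\<And>u. 0 \<le> u \<Longrightarrow> p \<le> measure (K u) {M..}"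
    using overshoot by blast
  have "h x \<le> D - p * (D - D / 2)" if "0 \<le> x" for x
    using sub[OF that] killed_op_le[OF h \<open>0 \<le> M\<close> _ _ le_D tail overshoot_M[OF that]] \<open>0 < D\<close> by force
  then have "D \<le> D - p * (D - D / 2)"
    unfolding D_def by (intro cSUP_least) auto
  then show False
    using mult_pos_pos[OF \<open>0 < p\<close> \<open>0 < D\<close>] by simp
qed

lemma sup_norm_funpow_killed_op_geometric:
  assumes h: "bounded_borel h" and b: "bounded_borel b" and vanishing: "(b \<longlongrightarrow> 0) at_top"
    and h_le: "\<And>u. 0 \<le> u \<Longrightarrow> \<bar>h u\<bar> \<le> b u" and super: "\<And>u. 0 \<le> u \<Longrightarrow> killed_op b u \<le> b u"
    and "0 < \<epsilon>"
  defines "e \<equiv> \<lambda>k. sup_norm ((killed_op ^^ k) h)"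
  shows "\<exists>q. 0 \<le> q \<and> q < 1 \<and> (\<forall>k. \<epsilon> \<le> e k \<longrightarrow> e k \<le> q ^ k * e 0)"
proof -
  have "\<forall>\<^sub>F x in at_top. 0 \<le> x \<and> b x < \<epsilon> / 2"
    using \<open>0 < \<epsilon>\<close> by (intro eventually_conj eventually_ge_at_top order_tendstoD[OF vanishing]) simp
  then obtain M where "0 \<le> M" and small: "\<And>x. M \<le> x \<Longrightarrow> b x < \<epsilon> / 2"
    unfolding eventually_at_top_linorder by blast
  have tail: "\<bar>(killed_op ^^ k) h x\<bar> \<le> \<epsilon> / 2" if "M \<le> x" for k x
    using abs_funpow_killed_op_le[OF h b h_le super, of x k] small[OF that] that \<open>0 \<le> M\<close>
    by linarith
  obtain p where "0 < p" and overshoot_M: "\<And>u. 0 \<le> u \<Longrightarrow> p \<le> measure (K u) {M..}"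
    using overshoot by blast
  have "p \<le> 1"
    using overshoot_M[of 0] kernel.prob_le_1 by (rule order_trans) simp
  have contract: "e (Suc k) \<le> (1 - p / 2) * e k" if "\<epsilon> \<le> e k" for k
  proof -
    have "e (Suc k) \<le> e k - p * (e k - \<epsilon> / 2)"
      using sup_norm_killed_op_le[OF bounded_borel_funpow_killed_op[OF h] \<open>0 \<le> M\<close> _ tail
          overshoot_M, of k] that \<open>0 < \<epsilon>\<close>
      by (simp add: e_def)
    also have "\<dots> \<le> (1 - p / 2) * e k"
      using mult_left_mono[OF that, of p] \<open>0 < p\<close> by (simp add: algebra_simps)
    finally show ?thesis .
  qed
  have "e k \<le> (1 - p / 2) ^ k * e 0" if "\<epsilon> \<le> e k" for k
    using decseq_sup_norm_funpow_killed_op[OF h] \<open>p \<le> 1\<close> contract that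
    by (intro geometric_bound_above_threshold[where \<epsilon>=\<epsilon>]) (auto simp: e_def)
  then show ?thesis
    using \<open>0 < p\<close> \<open>p \<le> 1\<close> by (intro exI[of _ "1 - p / 2"]) auto
qed

lemma tendsto_sup_norm_funpow_killed_op:
  assumes "bounded_borel h" and "bounded_borel b" and "(b \<longlongrightarrow> 0) at_top"
    and "\<And>u. 0 \<le> u \<Longrightarrow> \<bar>h u\<bar> \<le> b u" and "\<And>u. 0 \<le> u \<Longrightarrow> killed_op b u \<le> b u"
  shows "(\<lambda>k. sup_norm ((killed_op ^^ k) h)) \<longlonglongrightarrow> 0"
proof (rule tendsto_0_if_geometric_above_thresholds)
  show "0 \<le> sup_norm ((killed_op ^^ k) h)" for k
    by (rule sup_norm_nonneg[OF bounded_borel_funpow_killed_op[OF assms(1)]])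
qed (rule sup_norm_funpow_killed_op_geometric[OF assms])

end

section \<open>Measurability and exponential moments\<close>

lemma tendsto_floor_grid: "(\<lambda>n. of_int \<lfloor>x * real (Suc n)\<rfloor> / real (Suc n)) \<longlonglongrightarrow> (x :: real)"
proof (rule Lim_transform2[OF tendsto_const], rule Lim_null_comparison)
  show "(\<lambda>n. inverse (real (Suc n))) \<longlonglongrightarrow> 0"
    by (rule LIMSEQ_inverse_real_of_nat)
  have "\<bar>x - of_int \<lfloor>x * real (Suc n)\<rfloor> / real (Suc n)\<bar> \<le> inverse (real (Suc n))" for n
  proof -
    have "\<bar>x - of_int \<lfloor>x * real (Suc n)\<rfloor> / real (Suc n)\<bar>
        = \<bar>x * real (Suc n) - of_int \<lfloor>x * real (Suc n)\<rfloor>\<bar> / real (Suc n)"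
      by (simp add: divide_simps abs_divide[symmetric] del: of_nat_Suc)
    also have "\<dots> \<le> 1 / real (Suc n)"
      by (rule divide_right_mono) linarith+
    finally show ?thesis by (simp add: inverse_eq_divide)
  qed
  then show "\<forall>\<^sub>F n in sequentially.
      norm (x - of_int \<lfloor>x * real (Suc n)\<rfloor> / real (Suc n)) \<le> inverse (real (Suc n))"
    by simp
qed

lemma borel_measurable_Caratheodory:
  fixes g :: "'a \<Rightarrow> real \<Rightarrow> 'b::metric_space"
  assumes [measurable]: "\<And>t. (\<lambda>x. g x t) \<in> borel_measurable M"
    and cont: "\<And>x. x \<in> space M \<Longrightarrow> continuous_on UNIV (g x)"
  shows "(\<lambda>(x, t). g x t) \<in> borel_measurable (M \<Otimes>\<^sub>M borel)"
proof (rule borel_measurable_LIMSEQ_metric)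
  let ?r = "\<lambda>n t. of_int \<lfloor>t * real (Suc n)\<rfloor> / real (Suc n)"
  show "(\<lambda>n. g (fst p) (?r n (snd p))) \<longlonglongrightarrow> (case p of (x, t) \<Rightarrow> g x t)"
    if "p \<in> space (M \<Otimes>\<^sub>M borel)" for p
  proof -
    have "isCont (g (fst p)) (snd p)"
      using that cont[of "fst p"]
      by (auto simp: space_pair_measure continuous_on_eq_continuous_at)
    then show ?thesis
      unfolding case_prod_beta using tendsto_floor_grid by (rule isCont_tendsto_compose)
  qed
  have "(\<lambda>p. (\<lambda>i p. g (fst p) (of_int i / real (Suc n))) \<lfloor>snd p * real (Suc n)\<rfloor> p)
      \<in> borel_measurable (M \<Otimes>\<^sub>M borel)" for n
    by (rule measurable_compose_countable) measurable
  then show "(\<lambda>p. g (fst p) (?r n (snd p))) \<in> borel_measurable (M \<Otimes>\<^sub>M borel)" for n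
    by simp
qed

lemma (in sigma_finite_measure) nn_integral_layer_cake:
  fixes f :: "'a \<Rightarrow> real" and g :: "real \<Rightarrow> ennreal"
  assumes [measurable]: "f \<in> borel_measurable M" "g \<in> borel_measurable borel"
  shows "(\<integral>\<^sup>+x. (\<integral>\<^sup>+s\<in>{0..<f x}. g s \<partial>lborel) \<partial>M)
    = (\<integral>\<^sup>+s\<in>{0..}. g s * emeasure M {x \<in> space M. s < f x} \<partial>lborel)"
proof -
  interpret pair_sigma_finite M lborel ..
  have "(\<integral>\<^sup>+x. (\<integral>\<^sup>+s\<in>{0..<f x}. g s \<partial>lborel) \<partial>M)
      = (\<integral>\<^sup>+x. (\<integral>\<^sup>+s. g s * indicator {0..} s * of_bool (s < f x) \<partial>lborel) \<partial>M)"
    by (intro nn_integral_cong) (auto simp: indicator_def)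
  also have "\<dots> = (\<integral>\<^sup>+s. (\<integral>\<^sup>+x. g s * indicator {0..} s * of_bool (s < f x) \<partial>M) \<partial>lborel)"
    by (rule Fubini'[symmetric]) measurable
  also have "\<dots> = (\<integral>\<^sup>+s\<in>{0..}. g s * emeasure M {x \<in> space M. s < f x} \<partial>lborel)"
  proof (rule nn_integral_cong)
    fix s :: real
    have "(\<integral>\<^sup>+x. of_bool (s < f x) \<partial>M) = (\<integral>\<^sup>+x. indicator {x \<in> space M. s < f x} x \<partial>M)"
      by (intro nn_integral_cong) (auto simp: indicator_def)
    then show "(\<integral>\<^sup>+x. g s * indicator {0..} s * of_bool (s < f x) \<partial>M)
        = g s * emeasure M {x \<in> space M. s < f x} * indicator {0..} s"
      by (simp add: nn_integral_cmult mult_ac)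
  qed
  finally show ?thesis .
qed

lemma exp_eq_1_plus_nn_integral:
  assumes "0 \<le> c" and "0 \<le> z"
  shows "ennreal (exp (c * z)) = 1 + (\<integral>\<^sup>+s\<in>{0..<z}. ennreal (c * exp (c * s)) \<partial>lborel)"
proof -
  have "(\<integral>\<^sup>+s\<in>{0..<z}. ennreal (c * exp (c * s)) \<partial>lborel)
      = (\<integral>\<^sup>+s\<in>{0..z}. ennreal (c * exp (c * s)) \<partial>lborel)"
    using AE_lborel_singleton[of z]
    by (intro nn_integral_cong_AE) (auto elim!: eventually_mono simp: indicator_def)
  also have "\<dots> = ennreal (exp (c * z) - exp (c * 0))"
    using assms by (intro nn_integral_FTC_Icc) (auto intro!: derivative_eq_intros)
  finally show ?thesis
    using assms by (simp flip: ennreal_1 ennreal_plus)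
qed

lemma (in prob_space) nn_integral_exp_eq_tail_integral:
  assumes [measurable]: "random_variable borel X" and "AE x in M. 0 \<le> X x" and "0 \<le> c"
  shows "(\<integral>\<^sup>+x. ennreal (exp (c * X x)) \<partial>M)
    = 1 + (\<integral>\<^sup>+s\<in>{0..}. ennreal (c * exp (c * s)) * emeasure M {x \<in> space M. s < X x} \<partial>lborel)"
proof -
  have "(\<lambda>x. \<integral>\<^sup>+s. ennreal (c * exp (c * s)) * of_bool (0 \<le> s \<and> s < X x) \<partial>lborel) \<in> borel_measurable M"
    by measurable
  then have [measurable]: "(\<lambda>x. \<integral>\<^sup>+s\<in>{0..<X x}. ennreal (c * exp (c * s)) \<partial>lborel) \<in> borel_measurable M"
    by (simp add: indicator_def)
  have "(\<integral>\<^sup>+x. ennreal (exp (c * X x)) \<partial>M)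
      = (\<integral>\<^sup>+x. 1 + (\<integral>\<^sup>+s\<in>{0..<X x}. ennreal (c * exp (c * s)) \<partial>lborel) \<partial>M)"
    using assms(2)
    by (intro nn_integral_cong_AE) (auto elim!: eventually_mono simp: exp_eq_1_plus_nn_integral[OF \<open>0 \<le> c\<close>])
  also have "\<dots> = 1 + (\<integral>\<^sup>+x. (\<integral>\<^sup>+s\<in>{0..<X x}. ennreal (c * exp (c * s)) \<partial>lborel) \<partial>M)"
    by (subst nn_integral_add) (auto simp: emeasure_space_1)
  also have "(\<integral>\<^sup>+x. (\<integral>\<^sup>+s\<in>{0..<X x}. ennreal (c * exp (c * s)) \<partial>lborel) \<partial>M)
      = (\<integral>\<^sup>+s\<in>{0..}. ennreal (c * exp (c * s)) * emeasure M {x \<in> space M. s < X x} \<partial>lborel)"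
    by (rule nn_integral_layer_cake) measurable
  finally show ?thesis .
qed

lemma nn_integral_exponential_density_exp:
  assumes "0 < l" and "0 \<le> s"
  shows "(\<integral>\<^sup>+t. ennreal (exp (- (s * t))) \<partial>density lborel (exponential_density l)) = ennreal (l / (l + s))"
proof -
  have rate_pos: "0 < l + s"
    using assms by simp
  interpret tilted: prob_space "density lborel (exponential_density (l + s))"
    using rate_pos by (rule prob_space_exponential_density)
  have tilt: "exponential_density l t * exp (- (s * t)) = l / (l + s) * exponential_density (l + s) t" for t
    using rate_pos by (simp add: exponential_density_def flip: exp_add) (simp add: algebra_simps)
  have "(\<integral>\<^sup>+t. ennreal (exp (- (s * t))) \<partial>density lborel (exponential_density l))
      = (\<integral>\<^sup>+t. ennreal (l / (l + s)) * ennreal (exponential_density (l + s) t) \<partial>lborel)"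
    using assms
    by (simp add: nn_integral_density exponential_density_nonneg tilt flip: ennreal_mult)
  also have "\<dots> = ennreal (l / (l + s))"
    using tilted.emeasure_space_1 by (simp add: nn_integral_cmult emeasure_density)
  finally show ?thesis .
qed

section \<open>The surplus after the next claim\<close>

locale risk_model =
  fixes \<alpha> :: real and F :: "real \<Rightarrow> real" and U :: "real \<Rightarrow> real \<Rightarrow> real"
  assumes \<alpha>_pos: "0 < \<alpha>"
    and claim_df: "claim_df F"
    and U_mono: "\<And>u v t. 0 \<le> u \<Longrightarrow> u \<le> v \<Longrightarrow> 0 \<le> t \<Longrightarrow> U u t \<le> U v t"
    and U_cont: "\<And>u. 0 \<le> u \<Longrightarrow> continuous_on {0..} (U u)"
    and U_at_top: "filterlim (U 0) at_top at_top"
begin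

abbreviation wait_law :: "real measure" where
  "wait_law \<equiv> density lborel (exponential_density \<alpha>)"

abbreviation claim_law :: "real measure" where
  "claim_law \<equiv> interval_measure F"

definition flow :: "real \<Rightarrow> real \<Rightarrow> real" where
  "flow u t = U (max 0 u) (max 0 t)"

definition surplus_law :: "real \<Rightarrow> real measure" where
  "surplus_law u = distr (wait_law \<Otimes>\<^sub>M claim_law) borel (\<lambda>\<omega>. flow u (fst \<omega>) - snd \<omega>)"

lemma
  shows F_mono: "x \<le> y \<Longrightarrow> F x \<le> F y" and F_right_cont: "continuous (at_right x) F"
    and F_at_top: "(F \<longlongrightarrow> 1) at_top" and F_nonpos: "z \<le> 0 \<Longrightarrow> F z = 0"
  using claim_df by (auto simp: claim_df_def mono_def)

lemma F_at_bot: "(F \<longlongrightarrow> 0) at_bot"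
  by (intro tendsto_eventually eventually_at_bot_linorderI[of 0]) (simp add: F_nonpos)

sublocale claim: prob_space claim_law
  using real_distribution_interval_measure[OF F_mono F_right_cont F_at_bot F_at_top]
  by (simp add: real_distribution_def)

sublocale wait: prob_space wait_law
  using \<alpha>_pos by (rule prob_space_exponential_density)

sublocale wait_claim: pair_prob_space wait_law claim_law ..

lemma prob_claim_atMost: "claim.prob {..x} = F x"
  by (intro measure_interval_measure_Iic F_mono F_right_cont F_at_bot)

lemma emeasure_claim_greaterThan: "emeasure claim_law {x<..} = ennreal (1 - F x)"
  using claim.prob_compl[of "{..x}"]
  by (simp add: claim.emeasure_eq_measure prob_claim_atMost flip: Compl_eq_Diff_UNIV)

lemma F_le_1: "F x \<le> 1"
  using claim.prob_le_1[of "{..x}"] by (simp add: prob_claim_atMost)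

lemma AE_claim_pos: "AE z in claim_law. 0 < z"
proof (rule AE_I)
  show "emeasure claim_law {..0} = 0"
    using prob_claim_atMost[of 0] F_nonpos[of 0] by (simp add: claim.emeasure_eq_measure)
qed auto

lemma measurable_flow_pair: "(\<lambda>(u, t). flow u t) \<in> borel_measurable (borel \<Otimes>\<^sub>M borel)"
proof (rule borel_measurable_Caratheodory)
  have "mono (\<lambda>u. flow u t)" for t
    by (auto simp: mono_def flow_def intro!: U_mono)
  then show "(\<lambda>u. flow u t) \<in> borel_measurable borel" for t
    by (rule borel_measurable_mono)
  show "continuous_on UNIV (flow u)" for u
    unfolding flow_def[abs_def]
    by (rule continuous_on_compose2[OF U_cont]) (auto intro!: continuous_intros)
qed

lemma measurable_flow [measurable (raw)]:
  assumes "f \<in> borel_measurable M" and "g \<in> borel_measurable M"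
  shows "(\<lambda>x. flow (f x) (g x)) \<in> borel_measurable M"
  using measurable_compose[OF measurable_Pair[OF assms] measurable_flow_pair] by simp

lemma measurable_surplus_law: "surplus_law \<in> borel \<rightarrow>\<^sub>M prob_algebra borel"
proof -
  have "wait_law \<Otimes>\<^sub>M claim_law \<in> space (prob_algebra (borel \<Otimes>\<^sub>M borel))"
    by (auto simp: space_prob_algebra wait_claim.prob_space_axioms intro: sets_pair_measure_cong)
  moreover have "(\<lambda>(u, \<omega>). flow u (fst \<omega>) - snd \<omega>) \<in> borel_measurable (borel \<Otimes>\<^sub>M (borel \<Otimes>\<^sub>M borel))"
    by measurable
  ultimately show ?thesis
    unfolding surplus_law_def[abs_def]
    by (intro measurable_distr_prob_space2 measurable_const)
qed

lemma wait_greaterThan_pos: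
  assumes "0 \<le> T"
  shows "0 < wait.prob {T<..}"
proof -
  have "distributed wait_law lborel (\<lambda>t. t) (exponential_density \<alpha>)"
    unfolding distributed_def by (auto simp: distr_id2)
  then show ?thesis
    using wait.exponential_distributedD_gt[of "\<lambda>t. t" \<alpha> T] assms \<alpha>_pos
    by (simp add: greaterThan_def)
qed

text \<open>Since \<open>U u t \<ge> U 0 t\<close>, a late and small first claim leaves the surplus above \<open>M\<close> with a
  probability that is bounded below uniformly in \<open>u\<close>.\<close>

lemma surplus_law_overshoot: "\<exists>p>0. \<forall>u\<ge>0. p \<le> measure (surplus_law u) {M..}"
proof -
  have "\<forall>\<^sub>F z in at_top. 0 < F z"
    using F_at_top by (rule order_tendstoD) simp
  then obtain z0 where z0: "0 < F z0"
    by (auto simp: eventually_at_top_linorder)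
  have "\<forall>\<^sub>F t in at_top. 0 \<le> t \<and> M + z0 \<le> U 0 t"
    using U_at_top by (intro eventually_conj eventually_ge_at_top) (simp add: filterlim_at_top)
  then obtain T where "0 \<le> T" and far: "\<And>t. T \<le> t \<Longrightarrow> M + z0 \<le> U 0 t"
    unfolding eventually_at_top_linorder by blast
  have "wait_claim.prob ({T<..} \<times> {..z0}) = wait.prob {T<..} * claim.prob {..z0}"
    by (simp add: measure_def claim.emeasure_pair_measure_Times enn2real_mult)
  then have prob_times: "wait_claim.prob ({T<..} \<times> {..z0}) = wait.prob {T<..} * F z0"
    by (simp add: prob_claim_atMost)
  have "wait.prob {T<..} * F z0 \<le> measure (surplus_law u) {M..}" if "0 \<le> u" for u
  proof -
    have "wait_claim.prob ({T<..} \<times> {..z0})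
        \<le> wait_claim.prob ((\<lambda>\<omega>. flow u (fst \<omega>) - snd \<omega>) -` {M..} \<inter> space (wait_law \<Otimes>\<^sub>M claim_law))"
    proof (rule wait_claim.finite_measure_mono)
      have "M \<le> flow u t - z" if "T < t" and "z \<le> z0" for t z
        using far[of t] U_mono[of 0 u t] that \<open>0 \<le> u\<close> \<open>0 \<le> T\<close> by (simp add: flow_def)
      then show "{T<..} \<times> {..z0}
          \<subseteq> (\<lambda>\<omega>. flow u (fst \<omega>) - snd \<omega>) -` {M..} \<inter> space (wait_law \<Otimes>\<^sub>M claim_law)"
        by (auto simp: space_pair_measure)
    qed measurable
    then show ?thesis
      by (simp add: surplus_law_def measure_distr prob_times)
  qed
  moreover have "0 < wait.prob {T<..} * F z0"
    using wait_greaterThan_pos[OF \<open>0 \<le> T\<close>] z0 by simp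
  ultimately show ?thesis by blast
qed

sublocale overshooting_kernel surplus_law
  by unfold_locales (rule measurable_surplus_law surplus_law_overshoot)+

lemma killed_op_iterated:
  assumes f: "bounded_borel f"
  shows "killed_op f u
    = (\<integral>t. (\<integral>z. indicator {0..} (flow u t - z) * f (flow u t - z) \<partial>claim_law) \<partial>wait_law)"
proof -
  note [measurable] = bounded_borel_measurable[OF f]
  have "integrable (surplus_law u) (\<lambda>x. indicator {0..} x * f x)"
    using set_integrable_kernel[OF f] by (simp add: set_integrable_def)
  then have "integrable (wait_law \<Otimes>\<^sub>M claim_law)
      (\<lambda>\<omega>. indicator {0..} (flow u (fst \<omega>) - snd \<omega>) * f (flow u (fst \<omega>) - snd \<omega>))"
    unfolding surplus_law_def by (subst (asm) integrable_distr_eq) simp_all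
  from wait_claim.integral_fst'[OF this] show ?thesis
    unfolding killed_op_def set_lebesgue_integral_def surplus_law_def
    by (subst integral_distr) simp_all
qed

lemma risk_op_eq_killed_op:
  assumes f: "bounded_borel f" and "0 \<le> u"
  shows "risk_op \<alpha> F U f u = killed_op f u"
proof -
  note [measurable] = bounded_borel_measurable[OF f]
  define g where "g t = (\<integral>z. indicator {0..} (flow u t - z) * f (flow u t - z) \<partial>claim_law)" for t
  have [measurable]: "g \<in> borel_measurable borel"
    unfolding g_def[abs_def] by measurable
  have claim_integral: "(LINT z:{0..U u t}|claim_law. f (U u t - z)) = g t" if "0 \<le> t" for t
  proof -
    have "(LINT z:{0..U u t}|claim_law. f (U u t - z))
        = (\<integral>z. indicator {0..} z * (indicator {0..} (flow u t - z) * f (flow u t - z)) \<partial>claim_law)"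
      unfolding set_lebesgue_integral_def using \<open>0 \<le> u\<close> that
      by (intro Bochner_Integration.integral_cong) (auto simp: flow_def indicator_def)
    also have "\<dots> = g t"
      unfolding g_def using AE_claim_pos
      by (intro integral_cong_AE) (measurable, auto elim!: eventually_mono)
    finally show ?thesis .
  qed
  have "risk_op \<alpha> F U f u = (\<integral>t. exponential_density \<alpha> t *\<^sub>R g t \<partial>lborel)"
    unfolding risk_op_def set_lebesgue_integral_def[of lborel]
    by (intro Bochner_Integration.integral_cong)
      (auto simp: exponential_density_def indicator_def claim_integral mult.commute)
  also have "\<dots> = (\<integral>t. g t \<partial>wait_law)"
    using \<alpha>_pos by (intro integral_density[symmetric]) (auto simp: exponential_density_nonneg)
  also have "\<dots> = killed_op f u"
    by (simp add: g_def killed_op_iterated[OF f])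
  finally show ?thesis .
qed

lemma funpow_risk_op_eq_killed_op:
  assumes "bounded_borel f" and "0 \<le> u"
  shows "(risk_op \<alpha> F U ^^ k) f u = (killed_op ^^ k) f u"
  using assms(2)
proof (induction k arbitrary: u)
  case (Suc k)
  have "bounded_borel ((risk_op \<alpha> F U ^^ k) f)"
    using bounded_borel_cong[OF Suc.IH] bounded_borel_funpow_killed_op[OF assms(1)] by simp
  then have "(risk_op \<alpha> F U ^^ Suc k) f u = killed_op ((risk_op \<alpha> F U ^^ k) f) u"
    using Suc.prems by (simp add: risk_op_eq_killed_op)
  then show ?case
    using killed_op_cong[OF Suc.IH] by simp
qed simp

lemma sup_norm_risk_op_iterates_diff_fixed_point:
  assumes "bounded_borel f" and "bounded_borel g" and "\<And>u. 0 \<le> u \<Longrightarrow> g u = risk_op \<alpha> F U g u"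
  shows "sup_norm (\<lambda>u. (risk_op \<alpha> F U ^^ k) f u - g u)
    = sup_norm ((killed_op ^^ k) (\<lambda>u. f u - g u))"
  using assms
  by (intro sup_norm_cong)
    (simp add: funpow_risk_op_eq_killed_op funpow_killed_op_diff_fixed_point risk_op_eq_killed_op)

end

section \<open>The Lundberg bound\<close>

locale lundberg_model = risk_model +
  fixes ustar cstar L :: real
  assumes ustar_nonneg: "0 \<le> ustar" and cstar_pos: "0 < cstar" and L_pos: "0 < L"
    and growth: "\<And>u t. ustar \<le> u \<Longrightarrow> 0 \<le> t \<Longrightarrow> u + cstar * t \<le> U u t"
    and tail_integrable: "set_integrable lborel {0..} (\<lambda>z. exp (L * z) * (1 - F z))"
    and lundberg_condition:
      "\<alpha> / cstar * (LINT z:{0..}|lborel. exp (L * z) * (1 - F z)) \<le> 1"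
begin

definition ruin_bound :: "real \<Rightarrow> real" where
  "ruin_bound x = min 1 (exp (- L * (x - ustar)))"

lemma ruin_bound_nonneg: "0 \<le> ruin_bound x"
  and ruin_bound_le_1: "ruin_bound x \<le> 1"
  by (simp_all add: ruin_bound_def)

lemma ruin_bound_eq_1: "x \<le> ustar \<Longrightarrow> ruin_bound x = 1"
  using L_pos by (simp add: ruin_bound_def mult_le_0_iff)

lemma measurable_ruin_bound [measurable]: "ruin_bound \<in> borel_measurable borel"
  unfolding ruin_bound_def[abs_def] by measurable

lemma bounded_borel_ruin_bound: "bounded_borel ruin_bound"
  using ruin_bound_nonneg ruin_bound_le_1
  by (intro bounded_borelI[of _ 1]) (auto simp: set_borel_measurable_def)

lemma tendsto_ruin_bound: "(ruin_bound \<longlongrightarrow> 0) at_top"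
proof -
  have "((\<lambda>x. exp (- L * (x - ustar))) \<longlongrightarrow> 0) at_top"
    using L_pos by real_asymp
  then have "((\<lambda>x. min 1 (exp (- L * (x - ustar)))) \<longlongrightarrow> min 1 0) at_top"
    by (intro tendsto_min tendsto_const)
  then show ?thesis
    by (simp add: ruin_bound_def[abs_def])
qed

lemma nn_integral_exp_claim_le:
  "(\<integral>\<^sup>+z. ennreal (exp (L * z)) \<partial>claim_law) \<le> ennreal ((\<alpha> + L * cstar) / \<alpha>)"
proof -
  let ?I = "LINT z:{0..}|lborel. exp (L * z) * (1 - F z)"
  have "0 \<le> ?I"
    unfolding set_lebesgue_integral_def using F_le_1
    by (intro Bochner_Integration.integral_nonneg) auto
  have "(\<integral>\<^sup>+z. ennreal (exp (L * z)) \<partial>claim_law)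
      = 1 + (\<integral>\<^sup>+s\<in>{0..}. ennreal (L * exp (L * s)) * emeasure claim_law {s<..} \<partial>lborel)"
    using claim.nn_integral_exp_eq_tail_integral[of "\<lambda>z. z" L] AE_claim_pos L_pos
    by (simp add: greaterThan_def eventually_mono)
  also have "\<dots> = 1 + (\<integral>\<^sup>+s. ennreal (L * (indicator {0..} s *\<^sub>R (exp (L * s) * (1 - F s)))) \<partial>lborel)"
    using L_pos F_le_1
    by (intro arg_cong2[where f="(+)"] nn_integral_cong refl)
      (auto simp: emeasure_claim_greaterThan indicator_def ennreal_mult[symmetric] mult.assoc)
  also have "\<dots> = ennreal (1 + L * ?I)"
    using tail_integrable L_pos F_le_1 \<open>0 \<le> ?I\<close> unfolding set_lebesgue_integral_def
    by (subst nn_integral_eq_integral) (auto simp: set_integrable_def)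
  also have "\<dots> \<le> ennreal ((\<alpha> + L * cstar) / \<alpha>)"
    using lundberg_condition \<alpha>_pos L_pos cstar_pos by (intro ennreal_leI) (simp add: field_simps)
  finally show ?thesis .
qed

lemma ruin_bound_flow_le:
  assumes "ustar \<le> u"
  shows "ruin_bound (flow u t - z)
    \<le> exp (- L * (u - ustar)) * (exp (- (L * cstar * t)) * exp (L * z))"
proof -
  have "u + cstar * t \<le> u + cstar * max 0 t"
    using cstar_pos by simp
  also have "\<dots> \<le> flow u t"
    using growth[of u "max 0 t"] assms ustar_nonneg by (simp add: flow_def)
  finally have "- L * (flow u t - z - ustar) \<le> - L * (u + cstar * t - z - ustar)"
    using L_pos by simp
  also have "\<dots> = - L * (u - ustar) + (- (L * cstar * t) + L * z)"
    by (simp add: algebra_simps)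
  finally show ?thesis
    by (simp add: ruin_bound_def min.coboundedI2 flip: exp_add)
qed

lemma nn_integral_ruin_bound_le:
  assumes "ustar \<le> u"
  shows "(\<integral>\<^sup>+x. ennreal (ruin_bound x) \<partial>surplus_law u) \<le> ennreal (exp (- L * (u - ustar)))"
proof -
  let ?K = "exp (- L * (u - ustar))"
  have rate_pos: "0 < \<alpha> + L * cstar"
    using \<alpha>_pos L_pos cstar_pos by (simp add: add_pos_pos)
  have "(\<integral>\<^sup>+x. ennreal (ruin_bound x) \<partial>surplus_law u)
      = (\<integral>\<^sup>+t. (\<integral>\<^sup>+z. ennreal (ruin_bound (flow u t - z)) \<partial>claim_law) \<partial>wait_law)"
    unfolding surplus_law_def by (simp add: nn_integral_distr flip: claim.nn_integral_fst)
  also have "\<dots> \<le> (\<integral>\<^sup>+t. (\<integral>\<^sup>+z. ennreal ?K * (ennreal (exp (- (L * cstar * t))) * ennreal (exp (L * z)))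
      \<partial>claim_law) \<partial>wait_law)"
    using ruin_bound_flow_le[OF assms] by (intro nn_integral_mono) (simp flip: ennreal_mult)
  also have "\<dots> = ennreal ?K * ((\<integral>\<^sup>+t. ennreal (exp (- (L * cstar * t))) \<partial>wait_law)
      * (\<integral>\<^sup>+z. ennreal (exp (L * z)) \<partial>claim_law))"
    by (simp add: nn_integral_cmult nn_integral_multc)
  also have "\<dots> \<le> ennreal ?K * (ennreal (\<alpha> / (\<alpha> + L * cstar)) * ennreal ((\<alpha> + L * cstar) / \<alpha>))"
    using \<alpha>_pos L_pos cstar_pos nn_integral_exp_claim_le
    by (simp add: nn_integral_exponential_density_exp mult_left_mono)
  also have "\<dots> = ennreal ?K"
    using \<alpha>_pos rate_pos by (simp flip: ennreal_mult)
  finally show ?thesis .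
qed

lemma integrable_ruin_bound: "integrable (surplus_law u) ruin_bound"
  using ruin_bound_nonneg ruin_bound_le_1
  by (intro kernel.integrable_const_bound[of _ 1]) auto

lemma integral_ruin_bound_le: "(\<integral>x. ruin_bound x \<partial>surplus_law u) \<le> ruin_bound u"
proof -
  have expectation_le_1: "(\<integral>x. ruin_bound x \<partial>surplus_law u) \<le> 1"
    using ruin_bound_le_1 by (intro kernel.integral_le_const integrable_ruin_bound) auto
  show ?thesis
  proof (cases "u \<le> ustar")
    case True
    with expectation_le_1 show ?thesis by (simp add: ruin_bound_eq_1)
  next
    case False
    then have "(\<integral>x. ruin_bound x \<partial>surplus_law u) \<le> exp (- L * (u - ustar))"
      using nn_integral_ruin_bound_le[of u]
      by (simp add: integral_eq_nn_integral ruin_bound_nonneg enn2real_leI)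
    with expectation_le_1 show ?thesis by (simp add: ruin_bound_def[of u])
  qed
qed

lemma killed_op_ruin_bound_le: "killed_op ruin_bound u \<le> ruin_bound u"
proof -
  have "killed_op ruin_bound u \<le> (\<integral>x. ruin_bound x \<partial>surplus_law u)"
    unfolding killed_op_def set_lebesgue_integral_def
    using set_integrable_kernel[OF bounded_borel_ruin_bound]
    by (intro integral_mono integrable_ruin_bound)
      (auto simp: set_integrable_def indicator_def ruin_bound_nonneg)
  also have "\<dots> \<le> ruin_bound u"
    by (rule integral_ruin_bound_le)
  finally show ?thesis .
qed

text \<open>The truncation at 1 matters here: \<open>1 - ruin_bound\<close> vanishes on the negative axis, so that
  killing does not change its expectation.\<close>

lemma survival_bound_le_killed_op: "1 - ruin_bound u \<le> killed_op (\<lambda>x. 1 - ruin_bound x) u"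
proof -
  have "killed_op (\<lambda>x. 1 - ruin_bound x) u = (\<integral>x. 1 - ruin_bound x \<partial>surplus_law u)"
    unfolding killed_op_def set_lebesgue_integral_def
    using ruin_bound_eq_1 ustar_nonneg
    by (intro Bochner_Integration.integral_cong) (auto simp: indicator_def)
  also have "\<dots> = 1 - (\<integral>x. ruin_bound x \<partial>surplus_law u)"
    using integrable_ruin_bound by (simp add: kernel.prob_space)
  finally show ?thesis
    using integral_ruin_bound_le[of u] by simp
qed

lemma lundberg_inequality:
  assumes \<phi>: "bounded_borel \<phi>" and fixed: "\<And>u. 0 \<le> u \<Longrightarrow> \<phi> u = risk_op \<alpha> F U \<phi> u"
    and lim: "(\<phi> \<longlongrightarrow> 1) at_top" and "0 \<le> u"
  shows "1 - \<phi> u \<le> ruin_bound u"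
proof -
  have survival: "bounded_borel (\<lambda>x. 1 - ruin_bound x)"
    using ruin_bound_nonneg ruin_bound_le_1
    by (intro bounded_borelI[of _ 1]) (auto simp: set_borel_measurable_def)
  have "1 - ruin_bound u - \<phi> u \<le> 0"
  proof (rule nonpos_of_le_killed_op[where h="\<lambda>x. 1 - ruin_bound x - \<phi> x"])
    show "bounded_borel (\<lambda>x. 1 - ruin_bound x - \<phi> x)"
      by (rule bounded_borel_diff[OF survival \<phi>])
    show "1 - ruin_bound x - \<phi> x \<le> killed_op (\<lambda>x. 1 - ruin_bound x - \<phi> x) x" if "0 \<le> x" for x
      using survival_bound_le_killed_op[of x] fixed[OF that]
      by (simp add: killed_op_diff[OF survival \<phi>] risk_op_eq_killed_op[OF \<phi> that])
    show "\<forall>\<^sub>F x in at_top. 1 - ruin_bound x - \<phi> x \<le> \<epsilon>" if "0 < \<epsilon>" for \<epsilon>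
    proof -
      have "\<forall>\<^sub>F x in at_top. 1 - \<epsilon> < \<phi> x"
        using lim that by (intro order_tendstoD) auto
      then show ?thesis
        by eventually_elim (use ruin_bound_nonneg in \<open>smt (verit)\<close>)
    qed
  qed (rule \<open>0 \<le> u\<close>)
  then show ?thesis by simp
qed

end

theorem theorem4p2:
  fixes \<alpha> ustar cstar L :: real
    and F c \<phi> \<phi>0 :: "real \<Rightarrow> real"
    and U :: "real \<Rightarrow> real \<Rightarrow> real"
  assumes "\<alpha> > 0"
    and "claim_df F"
    and "integrable (interval_measure F) (\<lambda>z. z)"
    and "\<forall>u\<ge>0. c u \<ge> 0"
    and "piecewise_continuous c"
    and "premium_flow c U"
    and "\<forall>u v t. 0 \<le> u \<longrightarrow> u \<le> v \<longrightarrow> 0 \<le> t \<longrightarrow> U u t \<le> U v t"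
    and "\<forall>u s t. 0 \<le> u \<longrightarrow> 0 \<le> s \<longrightarrow> s \<le> t \<longrightarrow> U u s \<le> U u t"
    and "\<forall>u\<ge>0. filterlim (U u) at_top at_top"
    and "ustar \<ge> 0" and "cstar > 0" and "L > 0"
    and "\<forall>u\<ge>ustar. \<forall>t\<ge>0. U u t \<ge> u + cstar * t"
    and "set_integrable lborel {0..} (\<lambda>z. exp (L * z) * (1 - F z))"
    and "\<alpha> / cstar * (LINT z:{0..}|lborel. exp (L * z) * (1 - F z)) \<le> 1"
    and "\<forall>u\<ge>0. 0 \<le> \<phi> u \<and> \<phi> u \<le> 1"
    and "mono_on {0..} \<phi>"
    and "\<forall>u\<ge>0. \<phi> u = risk_op \<alpha> F U \<phi> u"
    and "(\<phi> \<longlongrightarrow> 1) at_top"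
    and "set_borel_measurable borel {0..} \<phi>0"
    and "\<forall>u\<ge>0. max 0 (1 - exp (- L * (u - ustar))) \<le> \<phi>0 u \<and> \<phi>0 u \<le> 1"
  defines "err \<equiv> \<lambda>k::nat. sup_norm (\<lambda>u. (risk_op \<alpha> F U ^^ k) \<phi>0 u - \<phi> u)"
  shows "decseq err \<and> err \<longlonglongrightarrow> 0 \<and>
    (\<forall>\<epsilon>>0. \<exists>q. 0 \<le> q \<and> q < 1 \<and> (\<forall>k. err k \<ge> \<epsilon> \<longrightarrow> err k \<le> q ^ k * err 0))"
proof -
  interpret lundberg_model \<alpha> F U ustar cstar L
    using assms(1,2,6,7,9-15)
    by unfold_locales (auto simp: premium_flow_def premium_solution_def)
  define h where "h u = \<phi>0 u - \<phi> u" for u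
  have \<phi>: "bounded_borel \<phi>"
    using assms(16) by (intro bounded_borel_mono_on[OF assms(17), of 1]) auto
  have \<phi>0: "bounded_borel \<phi>0"
    using assms(21) by (intro bounded_borelI[OF assms(20), of 1]) auto
  have h: "bounded_borel h"
    unfolding h_def by (rule bounded_borel_diff[OF \<phi>0 \<phi>])
  have err: "err = (\<lambda>k. sup_norm ((killed_op ^^ k) h))"
    unfolding err_def h_def using assms(18)
    by (simp add: sup_norm_risk_op_iterates_diff_fixed_point[OF \<phi>0 \<phi>])
  have "\<bar>h u\<bar> \<le> ruin_bound u" if "0 \<le> u" for u
    using lundberg_inequality[OF \<phi> _ assms(19) that] assms(16,18,21) that
    unfolding h_def ruin_bound_def by (smt (verit))
  note dominated = h bounded_borel_ruin_bound tendsto_ruin_bound this killed_op_ruin_bound_le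
  show ?thesis
    unfolding err
    using decseq_sup_norm_funpow_killed_op[OF h] tendsto_sup_norm_funpow_killed_op[OF dominated]
      sup_norm_funpow_killed_op_geometric[OF dominated]
    by blast
qed

end
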